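(* Over every countably infinite field there exists an $\omega_1$-Gross space of dimension $\aleph_1$.
   Context: For an infinite cardinal $\lambda$, a $\lambda$-Gross space over a field $F$ is an $F$-vector space $E$ with a symmetric bilinear form $\Phi:E\times E\to F$ such that every subspace $U\subseteq E$ with $\dim U\ge\lambda$ satisfies $\dim U^\perp<\dim E$, where $U^\perp=\{x\in E:\Phi(x,y)=0\ \forall y\in U\}$. *)

theory Defs
  imports "HOL.Vector_Spaces" "HOL-Library.Poly_Mapping" "HOL-Library.Countable_Set"
begin

unbundle cardinal_syntax

context vector_space
begin

text \<open>The library's \<open>dim\<close> is a natural number, and 0 on infinite-dimensional sets.
  This is the same definition with \<open>card\<close> replaced by the cardinal \<open>|_|\<close>;
  as for \<open>dim\<close>, the value depends only on the span of the argument.\<close>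

definition cdim :: "'b set \<Rightarrow> 'b rel" where
  "cdim V = |SOME B. independent B \<and> span B = span V|"

lemma card_of_independent_le:
  assumes B: "independent B" and C: "C \<subseteq> span B" and sp: "B \<subseteq> span C"
  shows "|B| \<le>o |C|"
proof (cases "finite C")
  case True
  then have "finite B \<and> card B \<le> card C"
    using independent_span_bound[OF True B sp] by simp
  then show ?thesis using True
    by (metis card_le_inj[OF _ True] card_of_ordLeq)
next
  case False
  have "\<exists>T. finite T \<and> T \<subseteq> B \<and> c \<in> span T" if "c \<in> C" for c
  proof -
    have "c \<in> span B" using that C by auto
    then obtain T r where "finite T" "T \<subseteq> B" "c = (\<Sum>a\<in>T. scale (r a) a)"
      unfolding span_explicit by auto
    then show ?thesis
      using span_sum[of T "\<lambda>a. scale (r a) a" T] by (auto intro: span_scale span_base)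
  qed
  then obtain T where T: "\<And>c. c \<in> C \<Longrightarrow> finite (T c) \<and> T c \<subseteq> B \<and> c \<in> span (T c)"
    by metis
  let ?U = "\<Union>c\<in>C. T c"
  have "C \<subseteq> span ?U"
    using T span_mono[of "T _" ?U] by blast
  then have "B \<subseteq> span ?U"
    using sp span_minimal[OF _ subspace_span] by blast
  moreover have "?U \<subseteq> B" using T by blast
  ultimately have eq: "B = ?U"
    using spanning_subset_independent[OF _ B] by blast
  have "|?U| \<le>o |C|"
  proof (rule card_of_UNION_ordLeq_infinite[OF False])
    show "|C| \<le>o |C|" by (rule card_of_mono1) simp
    show "\<forall>c\<in>C. |T c| \<le>o |C|"
    proof
      fix c assume "c \<in> C"
      with T False have "|T c| <o |C|"
        by (intro finite_ordLess_infinite) (auto simp: Field_card_of card_of_well_order_on)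
      then show "|T c| \<le>o |C|" by (rule ordLess_imp_ordLeq)
    qed
  qed
  then show ?thesis using eq by simp
qed

lemma cdim_eq_card_of:
  assumes "independent B" and "span B = span V"
  shows "cdim V =o |B|"
proof -
  let ?P = "\<lambda>B. independent B \<and> span B = span V"
  have P: "?P (Eps ?P)" using assms by (intro someI[of ?P B]) simp
  then have eq: "span (Eps ?P) = span B" using assms by simp
  have "|Eps ?P| \<le>o |B|"
    by (rule card_of_independent_le) (use P eq span_superset in blast)+
  moreover have "|B| \<le>o |Eps ?P|"
    by (rule card_of_independent_le) (use assms(1) eq span_superset in blast)+
  ultimately show ?thesis unfolding cdim_def by (simp add: ordIso_iff_ordLeq)
qed

end

definition orthogonal_complement :: "('v \<Rightarrow> 'v \<Rightarrow> 'f::zero) \<Rightarrow> 'v set \<Rightarrow> 'v set" where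
  "orthogonal_complement \<Phi> U = {x. \<forall>y\<in>U. \<Phi> x y = 0}"

locale gross_space = vector_space scale
  for scale :: "'f::field \<Rightarrow> 'v::ab_group_add \<Rightarrow> 'v" +
  fixes \<Phi> :: "'v \<Rightarrow> 'v \<Rightarrow> 'f" and \<kappa> :: "'k rel"
  assumes infinite_cardinal: "Cinfinite \<kappa>"
    and symmetric: "\<Phi> x y = \<Phi> y x"
    and linear_left: "Vector_Spaces.linear scale (*) (\<lambda>x. \<Phi> x y)"
    and linear_right: "Vector_Spaces.linear scale (*) (\<Phi> x)"
    and cdim_orthogonal_complement:
      "subspace U \<Longrightarrow> \<kappa> \<le>o cdim U \<Longrightarrow> cdim (orthogonal_complement \<Phi> U) <o cdim UNIV"

text \<open>A type with exactly \<open>\<aleph>\<^sub>1\<close> elements. Existence of a vector space has to be asserted on some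
  concrete type; \<open>omega1 \<Rightarrow>\<^sub>0 'f\<close>, the finitely supported functions, is the direct sum of
  \<open>\<aleph>\<^sub>1\<close> copies of the field \<open>'f\<close>, so up to isomorphism the space of dimension \<open>\<aleph>\<^sub>1\<close>.\<close>

typedef omega1 = "Field (cardSuc natLeq)"
  using Field_cardSuc_not_empty[OF natLeq_Card_order] by blast

lemma card_of_omega1: "|UNIV :: omega1 set| =o cardSuc natLeq"
proof -
  have "bij_betw Rep_omega1 UNIV (Field (cardSuc natLeq))"
    by (simp add: bij_betw_def inj_on_def Rep_omega1_inject
        type_definition.Rep_range[OF type_definition_omega1])
  then have "|UNIV :: omega1 set| =o |Field (cardSuc natLeq)|"
    using card_of_ordIso by blast
  then show ?thesis
    using card_of_Field_ordIso[OF cardSuc_Card_order[OF natLeq_Card_order]] ordIso_transitive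
    by blast
qed

end

theory Submission
  imports Defs "HOL-Library.FuncSet" "HOL-Library.Countable_Set_Type"
begin

text \<open>Let \<open>r\<^sub>\<alpha>\<close> (\<open>\<alpha> < \<omega>\<^sub>1\<close>) be distinct elements of Cantor space. Choose a sequence \<open>x\<close> in the
  field that is generic: a linear combination of its terms with distinct indices and nonzero
  coefficients from a fixed finite set does not vanish, provided all the indices are large enough.
  For \<open>\<alpha> < \<beta>\<close> put \<open>\<Phi>(e\<^sub>\<alpha>, e\<^sub>\<beta>) = x\<^sub>c\<close>, where \<open>c\<close> codes \<open>n\<close>, \<open>r\<^sub>\<alpha>|n\<close> and \<open>r\<^sub>\<beta>|n\<close>, and \<open>n\<close> is the
  number of \<open>\<alpha>\<close> in a fixed enumeration of the countable set of predecessors of \<open>\<beta>\<close>.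

  Suppose that \<open>U\<close> and \<open>U\<^sup>\<bottom>\<close> are both uncountable. Restriction to a countable initial segment takes
  only countably many values, so both contain nonzero vectors supported above any countable ordinal.
  By the pigeonhole principle there are \<open>u\<^sub>0, u\<^sub>1, \<dots>\<close> in \<open>U\<close> with successive supports, coefficients
  in one fixed finite set, and supports that are separated by the \<open>r\<^sub>\<alpha>|N\<close> for one fixed \<open>N\<close>. Take
  \<open>w \<noteq> 0\<close> in \<open>U\<^sup>\<bottom>\<close> supported above all of them. As enumerations are injective, for some \<open>k\<close> all the
  numbers \<open>n\<close> occurring in \<open>\<Phi>(u\<^sub>k, w)\<close> are large; then the codes are distinct and large, and
  \<open>\<Phi>(u\<^sub>k, w) \<noteq> 0\<close> by genericity.\<close>

abbreviation lookup :: "('i \<Rightarrow>\<^sub>0 'f::zero) \<Rightarrow> 'i \<Rightarrow> 'f" where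
  "lookup \<equiv> Poly_Mapping.lookup"

abbreviation keys :: "('i \<Rightarrow>\<^sub>0 'f::zero) \<Rightarrow> 'i set" where
  "keys \<equiv> Poly_Mapping.keys"

section \<open>Generic sequences\<close>

text \<open>The bound \<open>K\<close> may depend on the coefficient set \<open>G\<close> but not on
  the number of terms. This matters because the blocks paired with a fixed vector may have supports
  of unbounded size.\<close>

definition generic_sequence :: "(nat \<Rightarrow> 'f::field) \<Rightarrow> bool" where
  "generic_sequence x \<longleftrightarrow> (\<forall>G. finite G \<longrightarrow> (\<exists>K. \<forall>I g. finite I \<and> I \<noteq> {} \<and> I \<subseteq> {K..} \<and> g ` I \<subseteq> G - {0}
     \<longrightarrow> (\<Sum>i\<in>I. g i * x i) \<noteq> 0))"

text \<open>Recursion: each new term avoids the finitely many values that would complete a vanishing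
  combination with coefficients among 0 and the first few field elements. An infinite field leaves a
  choice; countability puts every finite \<open>G\<close> inside \<open>C n\<close> for all large
  \<open>n\<close>.\<close>

lemma generic_sequence_exists:
  assumes inf: "infinite (UNIV :: 'f::field set)" and cnt: "countable (UNIV :: 'f set)"
  shows "\<exists>x :: nat \<Rightarrow> 'f. generic_sequence x"
proof -
  define f where "f = from_nat_into (UNIV :: 'f set)"
  have f: "range f = UNIV" unfolding f_def using cnt by (simp add: range_from_nat_into)
  define C where "C n = insert 0 (f ` {..n})" for n
  \<comment> \<open>The solutions for \<open>x n\<close> of a relation with last index
    \<open>n\<close>, where \<open>d\<close> is the coefficient of \<open>x n\<close>. As division
    by 0 gives 0, the case \<open>d = 0\<close> only adds the value 0.\<close>
  define bad where "bad x n = (\<lambda>(h, d). - (\<Sum>i<n. h i * x i) / d) `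
    (({..<n} \<rightarrow>\<^sub>E C n) \<times> C n)" for x :: "nat \<Rightarrow> 'f" and n :: nat
  have fin: "finite (bad x n)" for x n
    unfolding bad_def C_def by (intro finite_imageI finite_cartesian_product finite_PiE) auto
  \<comment> \<open>Only earlier terms matter, as the well-founded choice requires.\<close>
  have cong: "bad x n = bad y n" if "\<And>i. i < n \<Longrightarrow> x i = y i" for x y n
    unfolding bad_def using that by (intro image_cong) auto
  obtain x where x: "\<And>n. x n \<notin> bad x n"
  proof -
    have "\<exists>x. \<forall>n. x n \<notin> bad x n"
    proof (rule dependent_wf_choice[of less_than "\<lambda>x n y. y \<notin> bad x n"])
      show "\<exists>y. y \<notin> bad x n" for x n using fin inf ex_new_if_finite by blast
      fix x y :: "nat \<Rightarrow> 'f" and n a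
      assume "\<And>i. (i, n) \<in> less_than \<Longrightarrow> x i = y i"
      then have "bad x n = bad y n" by (intro cong) simp
      then show "(a \<notin> bad x n) = (a \<notin> bad y n)" by simp
    qed simp
    with that show ?thesis by blast
  qed
  have "\<exists>K. \<forall>I g. finite I \<and> I \<noteq> {} \<and> I \<subseteq> {K..} \<and> g ` I \<subseteq> G - {0} \<longrightarrow> (\<Sum>i\<in>I. g i * x i) \<noteq> 0"
    if "finite G" for G
  proof -
    obtain S where S: "finite S" "G = f ` S"
      using finite_subset_image[OF \<open>finite G\<close>, of f UNIV] f by blast
    then obtain K where "S \<subseteq> {..K}" using finite_nat_iff_bounded_le by blast
    then have G: "G \<subseteq> C n" if "n \<ge> K" for n
      using that S unfolding C_def by fastforce
    have "(\<Sum>i\<in>I. g i * x i) \<noteq> 0"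
      if I: "finite I" "I \<noteq> {}" "I \<subseteq> {K..}" "g ` I \<subseteq> G - {0}" for I g
    proof
      assume 0: "(\<Sum>i\<in>I. g i * x i) = 0"
      define m where "m = Max I"
      have m: "m \<in> I" "\<And>i. i \<in> I \<Longrightarrow> i \<le> m" using I by (auto simp: m_def)
      then have Gm: "G \<subseteq> C m" using I(3) by (intro G) auto
      \<comment> \<open>Padding with zeros turns a combination over \<open>I\<close> into one over
        all indices below \<open>m\<close>; this is why 0 was put into every
        \<open>C n\<close>.\<close>
      define h where "h = (\<lambda>i\<in>{..<m}. if i \<in> I then g i else 0)"
      have "(\<Sum>i<m. h i * x i) = (\<Sum>i\<in>I - {m}. g i * x i)"
        by (rule sum.mono_neutral_cong_right) (use m in \<open>auto simp: h_def le_less\<close>)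
      then have "x m * g m + (\<Sum>i<m. h i * x i) = 0"
        using 0 I m by (simp add: sum.remove[of I m] mult.commute)
      then have "x m * g m = - (\<Sum>i<m. h i * x i)"
        by (simp only: eq_neg_iff_add_eq_0)
      moreover have "g m \<noteq> 0" using I m by auto
      ultimately have "x m = - (\<Sum>i<m. h i * x i) / g m"
        by (metis nonzero_mult_div_cancel_right)
      moreover have gC: "g i \<in> C m" if "i \<in> I" for i using that I(4) Gm by blast
      then have "h \<in> {..<m} \<rightarrow>\<^sub>E C m" unfolding h_def by (auto simp: C_def[of m])
      moreover have "g m \<in> C m" using gC m by blast
      ultimately have "x m \<in> bad x m" unfolding bad_def
        by (intro image_eqI[of _ _ "(h, g m)"]) auto
      with x show False by blast
    qed
    then show ?thesis by blast
  qed
  then show ?thesis unfolding generic_sequence_def by blast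
qed

lemma generic_sequence_sum:
  assumes "generic_sequence x" and "finite G"
  obtains K where "\<And>P c g. \<lbrakk>finite P; P \<noteq> {}; inj_on c P; \<And>p. p \<in> P \<Longrightarrow> K \<le> c p; g ` P \<subseteq> G - {0}\<rbrakk>
    \<Longrightarrow> (\<Sum>p\<in>P. g p * x (c p)) \<noteq> 0"
proof -
  obtain K where K: "\<And>I g. \<lbrakk>finite I; I \<noteq> {}; I \<subseteq> {K..}; g ` I \<subseteq> G - {0}\<rbrakk> \<Longrightarrow> (\<Sum>i\<in>I. g i * x i) \<noteq> 0"
    using assms unfolding generic_sequence_def by meson
  show ?thesis
  proof (rule that[of K])
    fix P c g
    assume P: "finite P" "P \<noteq> {}" "inj_on c P" "\<And>p. p \<in> P \<Longrightarrow> K \<le> c p" "g ` P \<subseteq> G - {0}"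
    have "(\<Sum>p\<in>P. g p * x (c p)) = (\<Sum>i\<in>c ` P. g (inv_into P c i) * x i)"
      using P by (simp add: sum.reindex)
    also have "\<dots> \<noteq> 0" by (rule K) (use P in auto)
    finally show "(\<Sum>p\<in>P. g p * x (c p)) \<noteq> 0" .
  qed
qed

section \<open>The countable ordinals\<close>

instantiation omega1 :: linorder
begin

text \<open>The cardinal well-order on the type itself: its proper initial segments have smaller
  cardinality, hence are countable.\<close>

definition less_eq_omega1 :: "omega1 \<Rightarrow> omega1 \<Rightarrow> bool" where
  "\<alpha> \<le> \<beta> \<longleftrightarrow> (\<alpha>, \<beta>) \<in> |UNIV :: omega1 set|"

definition less_omega1 :: "omega1 \<Rightarrow> omega1 \<Rightarrow> bool" where
  "\<alpha> < \<beta> \<longleftrightarrow> \<alpha> \<le> \<beta> \<and> \<not> \<beta> \<le> (\<alpha> :: omega1)"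

instance
proof -
  have "linear_order |UNIV :: omega1 set|"
    using card_of_well_order_on[of "UNIV :: omega1 set"] by (simp add: well_order_on_def)
  then have "refl |UNIV :: omega1 set|" "trans |UNIV :: omega1 set|"
    "antisym |UNIV :: omega1 set|" "total |UNIV :: omega1 set|"
    by (auto simp: linear_order_on_def partial_order_on_def preorder_on_def)
  then show "OFCLASS(omega1, linorder_class)"
    by intro_classes
      (auto simp: less_eq_omega1_def less_omega1_def dest: refl_onD transD antisymD,
       metis UNIV_I refl_onD total_on_def)
qed

end

lemma countable_iff_ordLess_cardSuc: "countable A \<longleftrightarrow> |A| <o cardSuc natLeq"
  by (simp add: countable_card_le_natLeq cardSuc_ordLeq_ordLess[OF natLeq_Card_order card_of_Card_order])

lemma countable_lessThan_omega1: "countable {..<\<alpha> :: omega1}"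
proof -
  have "{..<\<alpha>} = underS |UNIV :: omega1 set| \<alpha>"
    by (auto simp: underS_def less_eq_omega1_def[symmetric])
  then have "|{..<\<alpha>}| <o |UNIV :: omega1 set|"
    using card_of_underS[OF card_of_Card_order[of "UNIV :: omega1 set"], of \<alpha>]
    by (simp add: Field_card_of)
  then show ?thesis
    using card_of_omega1 countable_iff_ordLess_cardSuc ordLess_ordIso_trans by blast
qed

lemma uncountable_omega1: "uncountable (UNIV :: omega1 set)"
  using card_of_omega1 countable_iff_ordLess_cardSuc not_ordLess_ordIso by blast

text \<open>A countable union of countable initial segments cannot exhaust the type.\<close>

lemma countable_omega1_bounded:
  assumes "countable (A :: omega1 set)"
  obtains \<delta> where "\<And>\<alpha>. \<alpha> \<in> A \<Longrightarrow> \<alpha> < \<delta>"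
proof -
  have "countable (\<Union>\<alpha>\<in>A. insert \<alpha> {..<\<alpha>})"
    using assms countable_lessThan_omega1 by auto
  then obtain \<delta> where "\<delta> \<notin> (\<Union>\<alpha>\<in>A. insert \<alpha> {..<\<alpha>})"
    using uncountable_omega1 by (metis UNIV_eq_I)
  then show ?thesis by (intro that[of \<delta>]) (auto simp: not_less_iff_gr_or_eq)
qed

text \<open>The successor cardinal of \<open>natLeq\<close> is the least one above it, so Cantor's
  theorem bounds it by the continuum.\<close>

lemma omega1_inj_cantor: "\<exists>r :: omega1 \<Rightarrow> nat \<Rightarrow> bool. inj r"
proof -
  have "|UNIV :: nat set| <o |UNIV :: nat set set|"
    using card_of_Pow[of "UNIV :: nat set"] by simp
  then have "natLeq <o |UNIV :: nat set set|"
    by (rule ordIso_ordLess_trans[OF ordIso_symmetric[OF card_of_nat]])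
  then have "cardSuc natLeq \<le>o |UNIV :: nat set set|"
    by (rule cardSuc_least[OF natLeq_Card_order card_of_Card_order])
  then have "|UNIV :: omega1 set| \<le>o |UNIV :: nat set set|"
    by (rule ordIso_ordLeq_trans[OF card_of_omega1])
  then obtain g :: "omega1 \<Rightarrow> nat set" where g: "inj g" by (auto simp: card_of_ordLeq[symmetric])
  have "inj (\<lambda>\<alpha> n. n \<in> g \<alpha>)"
    by (intro injI injD[OF g]) (simp add: fun_eq_iff set_eq_iff)
  then show ?thesis by blast
qed

section \<open>Codes of pairs\<close>

definition initial :: "('i \<Rightarrow> nat \<Rightarrow> bool) \<Rightarrow> nat \<Rightarrow> 'i \<Rightarrow> bool list" where
  "initial r n \<alpha> = map (r \<alpha>) [0..<n]"

text \<open>Each of the finitely many pairs is separated from some length on. All longer lengths are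
  included because the length used later is a rank, which varies with the pair.\<close>

lemma eventually_inj_on_initial:
  assumes "inj r" and "finite S"
  shows "\<forall>\<^sub>F n in sequentially. \<forall>m\<ge>n. inj_on (initial r m) S"
proof -
  have "\<forall>\<^sub>F n in sequentially. initial r n \<alpha> = initial r n \<beta> \<longrightarrow> \<alpha> = \<beta>" for \<alpha> \<beta>
  proof (cases "\<alpha> = \<beta>")
    case False
    then have "r \<alpha> \<noteq> r \<beta>" using assms(1) by (simp add: inj_eq)
    then obtain k where k: "r \<alpha> k \<noteq> r \<beta> k" by (auto simp: fun_eq_iff)
    have "initial r n \<alpha> \<noteq> initial r n \<beta>" if "n > k" for n
      using that k by (auto simp: initial_def)
    then show ?thesis by (intro eventually_mono[OF eventually_gt_at_top[of k]]) blast
  qed simp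
  then have "\<forall>\<^sub>F n in sequentially. \<forall>\<alpha>\<in>S. \<forall>\<beta>\<in>S. initial r n \<alpha> = initial r n \<beta> \<longrightarrow> \<alpha> = \<beta>"
    using assms(2) by (intro eventually_ball_finite ballI) auto
  then have "\<forall>\<^sub>F n in sequentially. inj_on (initial r n) S"
    by (simp add: inj_on_def)
  then show ?thesis by (simp add: eventually_all_ge_at_top)
qed

definition rank :: "omega1 \<Rightarrow> omega1 \<Rightarrow> nat" where
  "rank \<beta> \<alpha> = to_nat_on {..<\<beta>} \<alpha>"

lemma finite_rank_less: "finite {\<alpha>. \<alpha> < \<beta> \<and> rank \<beta> \<alpha> < n}"
proof (rule finite_imageD)
  show "finite (rank \<beta> ` {\<alpha>. \<alpha> < \<beta> \<and> rank \<beta> \<alpha> < n})"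
    by (rule finite_subset[of _ "{..<n}"]) auto
  show "inj_on (rank \<beta>) {\<alpha>. \<alpha> < \<beta> \<and> rank \<beta> \<alpha> < n}"
    using inj_on_to_nat_on[OF countable_lessThan_omega1[of \<beta>]]
    by (auto simp: rank_def[abs_def] inj_on_def)
qed

text \<open>Coding the length too ensures that equal codes compare restrictions of the same length.
  Finite boolean lists are countable, so \<open>to_nat\<close> applies.\<close>

definition pair_code :: "(omega1 \<Rightarrow> nat \<Rightarrow> bool) \<Rightarrow> omega1 \<Rightarrow> omega1 \<Rightarrow> nat" where
  "pair_code r \<alpha> \<beta> = (let n = rank \<beta> \<alpha> in
     prod_encode (n, to_nat (initial r n \<alpha>, initial r n \<beta>)))"

lemma pair_code_ge: "rank \<beta> \<alpha> \<le> pair_code r \<alpha> \<beta>"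
  by (simp add: pair_code_def Let_def le_prod_encode_1)

text \<open>Equal codes have the same rank, which is at least \<open>n\<close>; at that length the
  restrictions already determine both indices.\<close>

lemma inj_on_pair_code:
  assumes "\<And>\<alpha> \<beta>. \<alpha> \<in> A \<Longrightarrow> \<beta> \<in> B \<Longrightarrow> n \<le> rank \<beta> \<alpha>"
    and "\<forall>m\<ge>n. inj_on (initial r m) A" and "\<forall>m\<ge>n. inj_on (initial r m) B"
  shows "inj_on (\<lambda>(\<alpha>, \<beta>). pair_code r \<alpha> \<beta>) (A \<times> B)"
proof (rule inj_onI, clarify)
  fix \<alpha> \<beta> \<alpha>' \<beta>'
  assume in_sets: "\<alpha> \<in> A" "\<beta> \<in> B" "\<alpha>' \<in> A" "\<beta>' \<in> B"
    and "pair_code r \<alpha> \<beta> = pair_code r \<alpha>' \<beta>'"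
  then have "initial r (rank \<beta> \<alpha>) \<alpha> = initial r (rank \<beta> \<alpha>) \<alpha>'"
    "initial r (rank \<beta> \<alpha>) \<beta> = initial r (rank \<beta> \<alpha>) \<beta>'"
    by (auto simp: pair_code_def Let_def prod_encode_eq)
  with in_sets assms show "\<alpha> = \<alpha>' \<and> \<beta> = \<beta>'"
    by (meson inj_onD)
qed

section \<open>Finitely supported functions\<close>

definition pm_scale :: "'f::field \<Rightarrow> ('i \<Rightarrow>\<^sub>0 'f) \<Rightarrow> ('i \<Rightarrow>\<^sub>0 'f)" where
  "pm_scale c p = Poly_Mapping.map ((*) c) p"

lemma lookup_pm_scale [simp]: "lookup (pm_scale c p) i = c * lookup p i"
  by (simp add: pm_scale_def map.rep_eq when_def)

interpretation pm: vector_space pm_scale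
  by unfold_locales (auto intro!: poly_mapping_eqI simp: lookup_add algebra_simps)

lemma lookup_sum_pm: "lookup (\<Sum>a\<in>A. f a) i = (\<Sum>a\<in>A. lookup (f a) i)"
  by (induction A rule: infinite_finite_induct) (auto simp: lookup_add)

lemma lookup_sum_units:
  assumes "finite A"
  shows "lookup (\<Sum>i\<in>A. pm_scale (c i) (Poly_Mapping.single i 1)) j = (if j \<in> A then c j else 0)"
  using assms by (simp add: lookup_sum_pm lookup_single when_def if_distrib sum.delta cong: if_cong)

lemma inj_units: "inj (\<lambda>i. Poly_Mapping.single i (1 :: 'f::field))"
  by (rule injI) (metis lookup_single_eq lookup_single_not_eq one_neq_zero)

lemma independent_units: "pm.independent (range (\<lambda>i. Poly_Mapping.single i (1 :: 'f::field)))"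
  unfolding pm.independent_explicit_finite_subsets
proof (intro allI impI ballI)
  fix S :: "('i \<Rightarrow>\<^sub>0 'f) set" and u :: "('i \<Rightarrow>\<^sub>0 'f) \<Rightarrow> 'f" and v
  let ?e = "\<lambda>i. Poly_Mapping.single i (1 :: 'f)"
  assume "S \<subseteq> range ?e" "finite S" and 0: "(\<Sum>v\<in>S. pm_scale (u v) v) = 0" and v: "v \<in> S"
  then obtain A where A: "finite A" "S = ?e ` A" by (meson finite_subset_image)
  then obtain i where i: "i \<in> A" "v = ?e i" using v by auto
  have "(\<Sum>i\<in>A. pm_scale (u (?e i)) (?e i)) = 0"
    using 0 unfolding A(2) sum.reindex[OF inj_on_subset[OF inj_units subset_UNIV]] by (simp add: o_def)
  then show "u v = 0" using lookup_sum_units[OF A(1), of "\<lambda>i. u (?e i)" i] i by simp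
qed

lemma span_units: "pm.span (range (\<lambda>i. Poly_Mapping.single i (1 :: 'f::field))) = UNIV"
proof -
  have "p \<in> pm.span (range (\<lambda>i. Poly_Mapping.single i (1 :: 'f)))" for p :: "'i \<Rightarrow>\<^sub>0 'f"
  proof -
    have "p = (\<Sum>i\<in>keys p. pm_scale (lookup p i) (Poly_Mapping.single i 1))"
      by (rule poly_mapping_eqI) (simp add: lookup_sum_units in_keys_iff)
    also have "\<dots> \<in> pm.span (range (\<lambda>i. Poly_Mapping.single i 1))"
      by (intro pm.span_sum pm.span_scale pm.span_base) auto
    finally show ?thesis .
  qed
  then show ?thesis by blast
qed

lemma cdim_pm: "pm.cdim (UNIV :: ('i \<Rightarrow>\<^sub>0 'f::field) set) =o |UNIV :: 'i set|"
proof -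
  let ?B = "range (\<lambda>i :: 'i. Poly_Mapping.single i (1 :: 'f))"
  have "pm.cdim (UNIV :: ('i \<Rightarrow>\<^sub>0 'f) set) =o |?B|"
    by (rule pm.cdim_eq_card_of[OF independent_units]) (simp add: span_units)
  moreover have "|UNIV :: 'i set| =o |?B|"
    using inj_units card_of_ordIso unfolding bij_betw_def by blast
  ultimately show ?thesis using ordIso_symmetric ordIso_transitive by blast
qed

text \<open>A basis can be chosen inside \<open>V\<close>. This reduces the dimension estimates to
  countability of sets.\<close>

lemma (in vector_space) cdim_le_card_of: "cdim V \<le>o |V|"
proof -
  obtain B where B: "B \<subseteq> V" "independent B" "V \<subseteq> span B"
    using maximal_independent_subset by blast
  then have "span B = span V" by (metis span_eq span_superset subset_trans)
  then have "cdim V =o |B|" using B by (intro cdim_eq_card_of) auto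
  then show ?thesis using B(1) card_of_mono1 ordIso_ordLeq_trans by blast
qed

text \<open>Two vectors that agree below \<open>\<delta>\<close> exist by counting; take their difference.\<close>

lemma uncountable_subspace_high_support:
  fixes W :: "(omega1 \<Rightarrow>\<^sub>0 'f::field) set"
  assumes cnt: "countable (UNIV :: 'f set)" and unc: "uncountable W" and W: "pm.subspace W"
  obtains w where "w \<in> W" "w \<noteq> 0" "\<And>\<alpha>. \<alpha> \<in> keys w \<Longrightarrow> \<delta> \<le> \<alpha>"
proof -
  define g where "g w = (\<lambda>\<alpha>. (\<alpha>, lookup w \<alpha>)) ` (keys w \<inter> {..<\<delta>})" for w :: "omega1 \<Rightarrow>\<^sub>0 'f"
  have "g ` W \<subseteq> {S. S \<subseteq> {..<\<delta>} \<times> UNIV \<and> finite S}" by (auto simp: g_def)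
  moreover have "countable {S. S \<subseteq> {..<\<delta>} \<times> (UNIV :: 'f set) \<and> finite S}"
    using countable_Collect_finite_subset[of "{..<\<delta>} \<times> (UNIV :: 'f set)"]
      cnt countable_lessThan_omega1 by (simp add: conj_commute)
  ultimately have "countable (g ` W)" by (rule countable_subset)
  then have "\<not> inj_on g W" using unc countable_image_inj_on by blast
  then obtain u v where uv: "u \<in> W" "v \<in> W" "u \<noteq> v" "g u = g v" by (auto simp: inj_on_def)
  \<comment> \<open>The graph \<open>g w\<close> records nonzero values only, so agreement of
    \<open>u\<close> and \<open>v\<close> is tested from both sides.\<close>
  have g: "lookup w \<alpha> = a \<longleftrightarrow> (\<alpha>, a) \<in> g w" if "\<alpha> < \<delta>" "a \<noteq> 0" for w \<alpha> a
    using that by (auto simp: g_def in_keys_iff)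
  have "lookup u \<alpha> = lookup v \<alpha>" if "\<alpha> < \<delta>" for \<alpha>
    using g[OF that, of "lookup u \<alpha>" u] g[OF that, of "lookup u \<alpha>" v] 
      g[OF that, of "lookup v \<alpha>" u] g[OF that, of "lookup v \<alpha>" v] uv(4) by metis
  then have "\<delta> \<le> \<alpha>" if "\<alpha> \<in> keys (u - v)" for \<alpha>
    using that by (force simp: in_keys_iff lookup_minus not_less[symmetric])
  then show ?thesis using uv pm.subspace_diff[OF W] by (intro that[of "u - v"]) auto
qed

section \<open>Bilinear forms with a given matrix\<close>

definition gram_form :: "('i \<Rightarrow> 'i \<Rightarrow> 'f::field) \<Rightarrow> ('i \<Rightarrow>\<^sub>0 'f) \<Rightarrow> ('i \<Rightarrow>\<^sub>0 'f) \<Rightarrow> 'f" where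
  "gram_form M u w = (\<Sum>\<alpha>\<in>keys u. \<Sum>\<beta>\<in>keys w. lookup u \<alpha> * lookup w \<beta> * M \<alpha> \<beta>)"

lemma gram_form_commute:
  assumes "\<And>\<alpha> \<beta>. M \<alpha> \<beta> = M \<beta> \<alpha>"
  shows "gram_form M u w = gram_form M w u"
  unfolding gram_form_def
  by (subst sum.swap) (simp add: assms mult.commute[of "lookup u _"])

text \<open>Allows a common index set for several vectors, as additivity needs, since the extra
  terms vanish.\<close>

lemma gram_form_superset:
  assumes "finite A" "keys u \<subseteq> A"
  shows "gram_form M u w = (\<Sum>\<alpha>\<in>A. lookup u \<alpha> * (\<Sum>\<beta>\<in>keys w. lookup w \<beta> * M \<alpha> \<beta>))"
  unfolding gram_form_def sum_distrib_left mult.assoc[symmetric]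
  using assms by (intro sum.mono_neutral_left) (auto simp: in_keys_iff)

lemma linear_gram_form:
  fixes M :: "'i \<Rightarrow> 'i \<Rightarrow> 'f::field"
  shows "Vector_Spaces.linear pm_scale (*) (\<lambda>u. gram_form M u w)"
proof -
  have add: "gram_form M (u + v) w = gram_form M u w + gram_form M v w" for u v
    using keys_add[of u v] gram_form_superset[of "keys u \<union> keys v" "u + v" M w]
      gram_form_superset[of "keys u \<union> keys v" u M w] gram_form_superset[of "keys u \<union> keys v" v M w]
    by (simp add: lookup_add algebra_simps sum.distrib)
  have scale: "gram_form M (pm_scale c u) w = c * gram_form M u w" for c u
  proof -
    have "keys (pm_scale c u) \<subseteq> keys u" by (auto simp: in_keys_iff)
    then show ?thesis
      using gram_form_superset[of "keys u" "pm_scale c u" M w] gram_form_superset[of "keys u" u M w]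
      by (simp add: sum_distrib_left mult.assoc)
  qed
  have "vector_space ((*) :: 'f \<Rightarrow> 'f \<Rightarrow> 'f)"
    by unfold_locales (auto simp: algebra_simps)
  then show ?thesis
    using pm.vector_space_axioms add scale by (auto simp: Vector_Spaces.linear_iff)
qed

section \<open>The form\<close>

text \<open>The diagonal entries are irrelevant: there \<open>rank\<close> applies an enumeration outside its domain.\<close>

definition gross_matrix :: "(nat \<Rightarrow> 'f) \<Rightarrow> (omega1 \<Rightarrow> nat \<Rightarrow> bool) \<Rightarrow> omega1 \<Rightarrow> omega1 \<Rightarrow> 'f" where
  "gross_matrix x r \<alpha> \<beta> = x (pair_code r (min \<alpha> \<beta>) (max \<alpha> \<beta>))"

lemma gross_matrix_commute: "gross_matrix x r \<alpha> \<beta> = gross_matrix x r \<beta> \<alpha>"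
  by (simp add: gross_matrix_def min.commute max.commute)

text \<open>Pigeonhole over the countably many types \<open>N\<close>: some type occurs above every
  ordinal, and blocks of that type are then chosen one after another.\<close>

lemma uncountable_subspace_blocks:
  fixes U :: "(omega1 \<Rightarrow>\<^sub>0 'f::field) set"
  assumes cnt: "countable (UNIV :: 'f set)" and U: "uncountable U" "pm.subspace U" and r: "inj r"
  obtains N G and u :: "nat \<Rightarrow> omega1 \<Rightarrow>\<^sub>0 'f" where
    "finite G"
    "\<And>n. u n \<in> U \<and> u n \<noteq> 0 \<and> lookup (u n) ` keys (u n) \<subseteq> G \<and> (\<forall>m\<ge>N. inj_on (initial r m) (keys (u n)))"
    "\<And>n \<alpha> \<beta>. \<alpha> \<in> keys (u n) \<Longrightarrow> \<beta> \<in> keys (u (Suc n)) \<Longrightarrow> \<alpha> < \<beta>"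
proof -
  define f where "f = from_nat_into (UNIV :: 'f set)"
  have f: "range f = UNIV" unfolding f_def using cnt by (simp add: range_from_nat_into)
  \<comment> \<open>One number bounds both the coefficients, through the enumeration
    \<open>f\<close>, and the length at which the support is separated.\<close>
  define typed where "typed N u \<longleftrightarrow> u \<in> U \<and> u \<noteq> 0 \<and> lookup u ` keys u \<subseteq> f ` {..N} \<and>
    (\<forall>m\<ge>N. inj_on (initial r m) (keys u))" for N u
  have has_type: "\<exists>N. typed N u" if u: "u \<in> U" "u \<noteq> 0" for u
  proof -
    have "\<forall>\<^sub>F N in sequentially. a \<in> f ` {..N}" for a
    proof -
      obtain k where "a = f k" using f by (metis UNIV_I imageE)
      then show ?thesis by (auto intro: eventually_mono[OF eventually_ge_at_top[of k]])
    qed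
    then have "\<forall>\<^sub>F N in sequentially. \<forall>\<alpha>\<in>keys u. lookup u \<alpha> \<in> f ` {..N}"
      by (intro eventually_ball_finite) auto
    then have "\<forall>\<^sub>F N in sequentially. typed N u"
      using eventually_inj_on_initial[OF r finite_keys[of u]]
      by eventually_elim (use u in \<open>auto simp: typed_def\<close>)
    then show ?thesis by (rule eventually_happens'[OF sequentially_bot])
  qed
  have "\<exists>N. \<forall>\<gamma>. \<exists>u. typed N u \<and> (\<forall>\<alpha>\<in>keys u. \<gamma> < \<alpha>)"
  proof (rule ccontr)
    assume "\<not> ?thesis"
    then obtain \<gamma> where \<gamma>: "\<And>N u. typed N u \<Longrightarrow> \<exists>\<alpha>\<in>keys u. \<not> \<gamma> N < \<alpha>" by metis
    \<comment> \<open>If no type were unbounded, \<open>\<delta>\<close> would exceed all the bounds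
      \<open>\<gamma> N\<close>, and a nonzero vector of \<open>U\<close> supported from
      \<open>\<delta>\<close> on would have no type.\<close>
    obtain \<delta> where \<delta>: "\<And>\<alpha>. \<alpha> \<in> range \<gamma> \<Longrightarrow> \<alpha> < \<delta>" using countable_omega1_bounded[of "range \<gamma>"] by auto
    obtain u where u: "u \<in> U" "u \<noteq> 0" "\<And>\<alpha>. \<alpha> \<in> keys u \<Longrightarrow> \<delta> \<le> \<alpha>"
      using uncountable_subspace_high_support[OF cnt U] by metis
    obtain N where "typed N u" using has_type u by blast
    then show False using \<gamma>[of N u] u(3) \<delta>[of "\<gamma> N"] by force
  qed
  then obtain N where N: "\<And>\<gamma>. \<exists>u. typed N u \<and> (\<forall>\<alpha>\<in>keys u. \<gamma> < \<alpha>)" by blast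
  have "\<exists>u. \<forall>n. typed N (u n) \<and> (\<forall>\<alpha>\<in>keys (u n). \<forall>\<beta>\<in>keys (u (Suc n)). \<alpha> < \<beta>)"
  proof (rule dependent_nat_choice)
    show "\<exists>u. typed N u" using N by blast
  next
    fix u :: "omega1 \<Rightarrow>\<^sub>0 'f"
    obtain \<gamma> where "\<And>\<alpha>. \<alpha> \<in> keys u \<Longrightarrow> \<alpha> < \<gamma>"
      using countable_omega1_bounded[of "keys u"] countable_finite[OF finite_keys] by metis
    moreover obtain v where "typed N v" "\<forall>\<beta>\<in>keys v. \<gamma> < \<beta>" using N by blast
    ultimately show "\<exists>v. typed N v \<and> (\<forall>\<alpha>\<in>keys u. \<forall>\<beta>\<in>keys v. \<alpha> < \<beta>)"
      by (meson less_trans)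
  qed
  then obtain u where "\<And>n. typed N (u n)"
    "\<And>n \<alpha> \<beta>. \<alpha> \<in> keys (u n) \<Longrightarrow> \<beta> \<in> keys (u (Suc n)) \<Longrightarrow> \<alpha> < \<beta>" by blast
  then show ?thesis by (intro that[of "f ` {..N}" u N]) (auto simp: typed_def)
qed

lemma countable_orthogonal_complement:
  fixes U :: "(omega1 \<Rightarrow>\<^sub>0 'f::field) set"
  assumes cnt: "countable (UNIV :: 'f set)" and U: "uncountable U" "pm.subspace U"
    and r: "inj r" and x: "generic_sequence x"
  shows "countable (orthogonal_complement (gram_form (gross_matrix x r)) U)" (is "countable ?W")
proof (rule ccontr)
  assume unc: "uncountable ?W"
  let ?\<Phi> = "gram_form (gross_matrix x r)"
  have W: "pm.subspace ?W"
  proof -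
    interpret vector_space_pair "pm_scale :: 'f \<Rightarrow> (omega1 \<Rightarrow>\<^sub>0 'f) \<Rightarrow> _" "(*) :: 'f \<Rightarrow> 'f \<Rightarrow> 'f"
      by unfold_locales (auto simp: algebra_simps)
    show ?thesis
      using linear_0[OF linear_gram_form] linear_add[OF linear_gram_form]
        linear_scale[OF linear_gram_form]
      unfolding pm.subspace_def orthogonal_complement_def by auto
  qed
  obtain N G and u :: "nat \<Rightarrow> omega1 \<Rightarrow>\<^sub>0 'f" where G: "finite G"
    and u: "\<And>n. u n \<in> U \<and> u n \<noteq> 0 \<and> lookup (u n) ` keys (u n) \<subseteq> G \<and>
      (\<forall>m\<ge>N. inj_on (initial r m) (keys (u n)))"
    and succ: "\<And>n \<alpha> \<beta>. \<alpha> \<in> keys (u n) \<Longrightarrow> \<beta> \<in> keys (u (Suc n)) \<Longrightarrow> \<alpha> < \<beta>"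
    using uncountable_subspace_blocks[OF cnt U r] by metis
  obtain \<delta> where "\<And>\<alpha>. \<alpha> \<in> (\<Union>n. keys (u n)) \<Longrightarrow> \<alpha> < \<delta>"
    using countable_omega1_bounded[of "\<Union>n. keys (u n)"] countable_finite[OF finite_keys]
    by (metis countableI_type countable_UN)
  then have \<delta>: "\<And>n \<alpha>. \<alpha> \<in> keys (u n) \<Longrightarrow> \<alpha> < \<delta>" by blast
  obtain w where w: "w \<in> ?W" "w \<noteq> 0" "\<And>\<beta>. \<beta> \<in> keys w \<Longrightarrow> \<delta> \<le> \<beta>"
    using uncountable_subspace_high_support[OF cnt unc W] by metis
  obtain N' where N': "\<forall>m\<ge>N'. inj_on (initial r m) (keys w)"
    using eventually_happens'[OF sequentially_bot eventually_inj_on_initial[OF r finite_keys[of w]]]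
    by blast
  \<comment> \<open>The possible coefficients in a pairing of any block with \<open>w\<close>. They
    form a finite set fixed before \<open>n\<close> is chosen, and so \<open>K\<close> does not
    depend on \<open>n\<close>.\<close>
  define H where "H = (\<lambda>(a, b). a * b) ` (G \<times> lookup w ` keys w)"
  have "finite H" unfolding H_def using G by auto
  then obtain K where K: "\<And>(P :: (omega1 \<times> omega1) set) c g. \<lbrakk>finite P; P \<noteq> {}; inj_on c P;
      \<And>p. p \<in> P \<Longrightarrow> K \<le> c p; g ` P \<subseteq> H - {0}\<rbrakk> \<Longrightarrow> (\<Sum>p\<in>P. g p * x (c p)) \<noteq> 0"
    using generic_sequence_sum[OF x] by metis
  define M where "M = max K (max N N')"
  \<comment> \<open>The indices whose rank below some key of \<open>w\<close> is too small. There
    are finitely many, while the supports of the blocks are pairwise disjoint, so some block misses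
    them all.\<close>
  define Z where "Z = (\<Union>\<beta>\<in>keys w. {\<alpha>. \<alpha> < \<beta> \<and> rank \<beta> \<alpha> < M})"
  have "finite Z" unfolding Z_def using finite_rank_less by auto
  obtain n where n: "keys (u n) \<inter> Z = {}"
  proof (rule ccontr)
    assume "\<not> thesis"
    then have "\<forall>n. \<exists>z. z \<in> keys (u n) \<inter> Z" using that by blast
    then obtain z where z: "\<And>n. z n \<in> keys (u n) \<inter> Z" by metis
    \<comment> \<open>Successive supports make the chosen points strictly increasing, hence
      infinitely many in the finite set \<open>Z\<close>.\<close>
    then have "z n < z (Suc n)" for n using succ[of "z n" n "z (Suc n)"] by blast
    then have "strict_mono z" by (simp add: strict_mono_Suc_iff)
    then have "infinite (range z)"
      using finite_imageD strict_mono_imp_inj_on by blast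
    moreover have "range z \<subseteq> Z" using z by blast
    ultimately show False using \<open>finite Z\<close> finite_subset by blast
  qed
  let ?P = "keys (u n) \<times> keys w"
  have less: "\<alpha> < \<beta>" if "\<alpha> \<in> keys (u n)" "\<beta> \<in> keys w" for \<alpha> \<beta>
    using \<delta>[OF that(1)] w(3)[OF that(2)] by simp
  have rank: "M \<le> rank \<beta> \<alpha>" if "\<alpha> \<in> keys (u n)" "\<beta> \<in> keys w" for \<alpha> \<beta>
    using n that less[OF that] by (force simp: Z_def)
  have "?\<Phi> (u n) w = (\<Sum>(\<alpha>, \<beta>)\<in>?P. lookup (u n) \<alpha> * lookup w \<beta> * gross_matrix x r \<alpha> \<beta>)"
    unfolding gram_form_def by (simp add: sum.cartesian_product)
  also have "\<dots> = (\<Sum>p\<in>?P. (case p of (\<alpha>, \<beta>) \<Rightarrow> lookup (u n) \<alpha> * lookup w \<beta>) *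
      x (case p of (\<alpha>, \<beta>) \<Rightarrow> pair_code r \<alpha> \<beta>))"
    by (rule sum.cong)
      (auto simp: gross_matrix_def min_absorb1[OF less_imp_le[OF less]] max_absorb2[OF less_imp_le[OF less]])
  also have "\<dots> \<noteq> 0"
  proof (rule K)
    show "?P \<noteq> {}" using u[of n] w(2) by simp
    show "inj_on (\<lambda>(\<alpha>, \<beta>). pair_code r \<alpha> \<beta>) ?P"
      by (rule inj_on_pair_code[of _ _ M]) (use rank u[of n] N' in \<open>auto simp: M_def\<close>)
    show "K \<le> (case p of (\<alpha>, \<beta>) \<Rightarrow> pair_code r \<alpha> \<beta>)" if "p \<in> ?P" for p
      using that rank order_trans[OF _ pair_code_ge] by (fastforce simp: M_def)
    show "(\<lambda>(\<alpha>, \<beta>). lookup (u n) \<alpha> * lookup w \<beta>) ` ?P \<subseteq> H - {0}"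
      using u[of n] by (fastforce simp: H_def in_keys_iff)
  qed simp
  finally have "?\<Phi> w (u n) \<noteq> 0"
    by (simp add: gram_form_commute[of "gross_matrix x r" w, OF gross_matrix_commute])
  then show False using w(1) u[of n] by (auto simp: orthogonal_complement_def)
qed

theorem theorem1:
  assumes "infinite (UNIV :: 'f::field set)" and "countable (UNIV :: 'f set)"
  shows "\<exists>(scale :: 'f \<Rightarrow> (omega1 \<Rightarrow>\<^sub>0 'f) \<Rightarrow> (omega1 \<Rightarrow>\<^sub>0 'f)) \<Phi>.
    gross_space scale \<Phi> (cardSuc natLeq) \<and>
    vector_space.cdim scale UNIV =o cardSuc natLeq"
proof -
  obtain x :: "nat \<Rightarrow> 'f" where x: "generic_sequence x"
    using generic_sequence_exists[OF assms] by blast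
  obtain r :: "omega1 \<Rightarrow> nat \<Rightarrow> bool" where r: "inj r" using omega1_inj_cantor by blast
  let ?\<Phi> = "gram_form (gross_matrix x r)"
  have dim: "pm.cdim (UNIV :: (omega1 \<Rightarrow>\<^sub>0 'f) set) =o cardSuc natLeq"
    using cdim_pm card_of_omega1 ordIso_transitive by blast
  have sym: "?\<Phi> u v = ?\<Phi> v u" for u v
    by (rule gram_form_commute[OF gross_matrix_commute])
  have "gross_space pm_scale ?\<Phi> (cardSuc natLeq)"
  proof (intro gross_space.intro gross_space_axioms.intro)
    show "vector_space (pm_scale :: 'f \<Rightarrow> (omega1 \<Rightarrow>\<^sub>0 'f) \<Rightarrow> _)" by (rule pm.vector_space_axioms)
    show "Cinfinite (cardSuc natLeq)" by (rule Cinfinite_cardSuc[OF natLeq_Cinfinite])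
    show "?\<Phi> u v = ?\<Phi> v u" for u v by (rule sym)
    show "Vector_Spaces.linear pm_scale (*) (\<lambda>u. ?\<Phi> u v)" for v by (rule linear_gram_form)
    have "?\<Phi> u = (\<lambda>v. ?\<Phi> v u)" for u using sym by (rule ext)
    then show "Vector_Spaces.linear pm_scale (*) (?\<Phi> u)" for u using linear_gram_form by metis
    fix U :: "(omega1 \<Rightarrow>\<^sub>0 'f) set"
    assume U: "pm.subspace U" "cardSuc natLeq \<le>o pm.cdim U"
    \<comment> \<open>Dimension is replaced by cardinality here, and again for the complement: a
      countable set has countable dimension.\<close>
    have "cardSuc natLeq \<le>o |U|" using U(2) pm.cdim_le_card_of ordLeq_transitive by blast
    then have "uncountable U" using countable_iff_ordLess_cardSuc not_ordLess_ordLeq by blast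
    then have "countable (orthogonal_complement ?\<Phi> U)"
      using countable_orthogonal_complement assms(2) U(1) r x by blast
    then have "pm.cdim (orthogonal_complement ?\<Phi> U) <o cardSuc natLeq"
      using pm.cdim_le_card_of countable_iff_ordLess_cardSuc ordLeq_ordLess_trans by blast
    then show "pm.cdim (orthogonal_complement ?\<Phi> U) <o pm.cdim (UNIV :: (omega1 \<Rightarrow>\<^sub>0 'f) set)"
      using dim ordIso_symmetric ordLess_ordIso_trans by blast
  qed
  with dim show ?thesis by blast
qed

end
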